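(* Let $r\in\mathbb{N}$ ($r\ge 1$), $1\le s<\infty$, $1\le p\le\infty$, and $\mu>2r-\frac1s+\frac12$ (with $1/p=0$ if $p=\infty$). For any constants $C_1,C_2>0$ there is a constant $c>0$, independent of $f$, $f^\delta$, $\delta$ and $N$, such that the following holds. Let $0<\delta<1$, let $f\in W_s^\mu$ with $\|f\|_{s,\mu}\le 1$, let $(\langle f^\delta,\varphi_k\rangle)_{k\ge0}$ be a sequence of real numbers such that $\xi_k=\langle f,\varphi_k\rangle-\langle f^\delta,\varphi_k\rangle$ satisfies $\|(\xi_k)_{k\ge 0}\|_{\ell_p}\le\delta$, and let $N\ge r$ be an integer with $N\asymp\delta^{-\frac{1}{\mu-1/p+1/s}}$, i.e. $C_1\delta^{-\frac{1}{\mu-1/p+1/s}}\le N\le C_2\delta^{-\frac{1}{\mu-1/p+1/s}}$. Then $$\|f^{(r)}-\mathcal{D}_N^{(r)}f^\delta\|_{2}\le c\,\delta^{\frac{\mu-2r+1/s-1/2}{\mu-1/p+1/s}}.$$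
   Context: $L_2$ is the usual space of real-valued square-integrable functions on $[-1,1]$ (Lebesgue measure) with norm $\|\cdot\|_2$. The orthonormal Legendre polynomials on $[-1,1]$ are $\varphi_k(t)=\sqrt{k+1/2}\,(2^kk!)^{-1}\frac{d^k}{dt^k}[(t^2-1)^k]$, $k=0,1,2,\dots$. For $f\in L_2$, $\langle f,\varphi_k\rangle=\int_{-1}^1 f(t)\varphi_k(t)\,dt$. For $\mu>0$, $1\le s<\infty$, the weighted Wiener class is $W_s^\mu=\{f\in L_2:\ \|f\|_{s,\mu}^s:=\sum_{k=0}^\infty(\max\{1,k\})^{s\mu}|\langle f,\varphi_k\rangle|^s<\infty\}$. For $f\in W_s^\mu$, the derivative of order $r$ is represented as (and understood through) the series $f^{(r)}=\sum_{k=r}^\infty\langle f,\varphi_k\rangle\varphi_k^{(r)}$, with convergence in the metric in which the error is measured. $\ell_p$ is the usual space of real sequences with norm $\|x\|_{\ell_p}=(\sum_k|x_k|^p)^{1/p}$ for $p<\infty$ and $\sup_k|x_k|$ for $p=\infty$. The perturbed data $f^\delta$ are given only through a sequence of real numbers denoted $\langle f^\delta,\varphi_k\rangle$, $k\ge0$ (perturbed Fourier-Legendre coefficients). The truncation method is $\mathcal{D}_N^{(r)}f^\delta(t)=\sum_{k=r}^N\langle f^\delta,\varphi_k\rangle\varphi_k^{(r)}(t)$. *)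

theory Defs
  imports "HOL-Analysis.Analysis" "HOL-Computational_Algebra.Polynomial"
begin

text \<open>Elements of \<open>L\<^sub>2\<close> are represented by functions \<open>real \<Rightarrow> real\<close>, of which only the values on
  \<open>[-1,1]\<close> matter; equality almost everywhere is not quotiented out.\<close>

definition L2 :: "(real \<Rightarrow> real) set" where
  "L2 = {f. f \<in> borel_measurable (lebesgue_on {-1..1}) \<and>
            integrable (lebesgue_on {-1..1}) (\<lambda>t. (f t)\<^sup>2)}"

definition L2_norm :: "(real \<Rightarrow> real) \<Rightarrow> real" where
  "L2_norm f = sqrt (integral\<^sup>L (lebesgue_on {-1..1}) (\<lambda>t. (f t)\<^sup>2))"

definition legendre :: "nat \<Rightarrow> real poly" where
  "legendre k = smult (sqrt (real k + 1/2) / (2 ^ k * fact k)) ((pderiv ^^ k) ([:-1, 0, 1:] ^ k))"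

definition legendre_deriv :: "nat \<Rightarrow> nat \<Rightarrow> real \<Rightarrow> real" where
  "legendre_deriv r k t = poly ((pderiv ^^ r) (legendre k)) t"

definition fl_coeff :: "(real \<Rightarrow> real) \<Rightarrow> nat \<Rightarrow> real" where
  "fl_coeff f k = integral\<^sup>L (lebesgue_on {-1..1}) (\<lambda>t. f t * poly (legendre k) t)"

definition wiener_term :: "real \<Rightarrow> real \<Rightarrow> (real \<Rightarrow> real) \<Rightarrow> nat \<Rightarrow> real" where
  "wiener_term s \<mu> f k = (max 1 (real k)) powr (s * \<mu>) * \<bar>fl_coeff f k\<bar> powr s"

definition wiener_class :: "real \<Rightarrow> real \<Rightarrow> (real \<Rightarrow> real) set" where
  "wiener_class s \<mu> = {f \<in> L2. summable (wiener_term s \<mu> f)}"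

definition wiener_norm :: "real \<Rightarrow> real \<Rightarrow> (real \<Rightarrow> real) \<Rightarrow> real" where
  "wiener_norm s \<mu> f = (\<Sum>k. wiener_term s \<mu> f k) powr (1 / s)"

text \<open>The spaces \<open>\<ell>\<^sub>p\<close> and their norms, meant for \<open>1 \<le> p \<le> \<infinity>\<close>.\<close>

definition lp_space :: "ereal \<Rightarrow> (nat \<Rightarrow> real) set" where
  "lp_space p = {x. if p = \<infinity> then bdd_above (range (\<lambda>k. \<bar>x k\<bar>))
                    else summable (\<lambda>k. \<bar>x k\<bar> powr real_of_ereal p)}"

definition lp_norm :: "ereal \<Rightarrow> (nat \<Rightarrow> real) \<Rightarrow> real" where
  "lp_norm p x = (if p = \<infinity> then (SUP k. \<bar>x k\<bar>)
                  else (\<Sum>k. \<bar>x k\<bar> powr real_of_ereal p) powr (1 / real_of_ereal p))"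

text \<open>The sum \<open>\<Sum>k=r..N. y k * \<phi>\<^sub>k\<^sup>(\<^sup>r\<^sup>)\<close>. For exact coefficients \<open>y\<close> it is a partial sum of the
  series representing the derivative, for perturbed ones it is the truncation method.\<close>

definition trunc_deriv :: "nat \<Rightarrow> nat \<Rightarrow> (nat \<Rightarrow> real) \<Rightarrow> real \<Rightarrow> real" where
  "trunc_deriv r N y t = (\<Sum>k=r..N. y k * legendre_deriv r k t)"

text \<open>\<open>g\<close> is (a representative of) the derivative of order \<open>r\<close> of \<open>f\<close>, understood as the \<open>L\<^sub>2\<close>-limit
  of the termwise differentiated Fourier-Legendre series.\<close>

definition has_series_deriv :: "nat \<Rightarrow> (real \<Rightarrow> real) \<Rightarrow> (real \<Rightarrow> real) \<Rightarrow> bool" where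
  "has_series_deriv r f g \<longleftrightarrow> g \<in> L2 \<and>
     (\<lambda>n. L2_norm (\<lambda>t. g t - trunc_deriv r n (fl_coeff f) t)) \<longlonglongrightarrow> 0"

end

theory Submission
  imports Defs
begin

text \<open>Write \<open>\<phi>\<^sub>k\<close> for the orthonormal Legendre polynomials and \<open>a = 2 r - 1/2\<close>. Everything follows from
  one fact about Legendre polynomials, \<open>\<parallel>\<phi>\<^sub>k\<^sup>(\<^sup>r\<^sup>)\<parallel> \<le> C k\<^sup>a\<close> (\<open>L2_norm_legendre_deriv\<close>): with it, the
  triangle inequality alone gives the stated order.

  Indeed, the error is at most a constant times
  \<open>\<Sum>k>N. \<bar>c\<^sub>k\<bar> k\<^sup>a + \<Sum>r\<le>k\<le>N. \<bar>\<xi>\<^sub>k\<bar> k\<^sup>a\<close>, where \<open>c\<^sub>k\<close> are the coefficients of \<open>f\<close> and \<open>\<xi>\<^sub>k\<close> the noise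
  (\<open>L2_norm_truncation_error_le\<close>). Hoelder's inequality with the weights of the Wiener class bounds
  the first sum by a multiple of \<open>N powr (-\<beta>)\<close> with \<open>\<beta> = \<mu> - 2 r + 1/s - 1/2\<close>, and \<open>\<beta> > 0\<close> is exactly
  the assumption on \<open>\<mu>\<close> (\<open>wiener_unit_ball_tail_le\<close>). Hoelder's inequality in \<open>\<ell>\<^sub>p\<close> bounds the second
  sum by a multiple of \<open>\<delta> * N powr (a + 1 - 1/p)\<close> (\<open>lp_norm_le_imp_sum_le\<close>). For the prescribed size of
  \<open>N\<close> both bounds have the order stated in the theorem. The first estimate also shows that the
  differentiated series converges absolutely in \<open>L\<^sub>2\<close>, so that the derivative exists by completeness
  (\<open>L2_series_converges\<close>).

  For the norm bound let \<open>P\<^sub>k\<close> be the Legendre polynomials in the classical normalisation. Rodrigues'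
  formula gives \<open>P'\<^sub>k\<^sub>+\<^sub>2 = (2k+3) P\<^sub>k\<^sub>+\<^sub>1 + P'\<^sub>k\<close> and the values of \<open>P\<^sub>k\<close> at the endpoints;
  integration by parts and orthogonality to lower degrees give \<open>\<parallel>P'\<^sub>k\<parallel>\<^sup>2 \<le> k (k + 1)\<close>; and the recursion,
  summed with the triangle inequality, makes each further derivative cost a factor of order \<open>k\<^sup>2\<close>.\<close>

section \<open>The space of square-integrable functions on the interval\<close>

abbreviation "lebesgue_I \<equiv> lebesgue_on {-1..1::real}"

lemma L2_measurable [measurable_dest]: "f \<in> L2 \<Longrightarrow> f \<in> borel_measurable lebesgue_I"
  by (simp add: L2_def)

lemma L2_integrable_square: "f \<in> L2 \<Longrightarrow> integrable lebesgue_I (\<lambda>t. (f t)\<^sup>2)"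
  by (simp add: L2_def)

lemma L2_integrable_mult:
  assumes "f \<in> L2" "g \<in> L2"
  shows "integrable lebesgue_I (\<lambda>t. f t * g t)"
proof (rule Bochner_Integration.integrable_bound)
  show "integrable lebesgue_I (\<lambda>t. (f t)\<^sup>2 + (g t)\<^sup>2)"
    using assms by (intro Bochner_Integration.integrable_add L2_integrable_square)
  show "(\<lambda>t. f t * g t) \<in> borel_measurable lebesgue_I"
    using assms[THEN L2_measurable] by measurable
  have "norm (x * y) \<le> norm (x\<^sup>2 + y\<^sup>2)" for x y :: real
  proof -
    have "2 * (\<bar>x\<bar> * \<bar>y\<bar>) \<le> x\<^sup>2 + y\<^sup>2"
      using sum_squares_bound[of "\<bar>x\<bar>" "\<bar>y\<bar>"] by (simp add: mult.assoc)
    moreover have "0 \<le> \<bar>x\<bar> * \<bar>y\<bar>" by simp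
    ultimately have "\<bar>x\<bar> * \<bar>y\<bar> \<le> x\<^sup>2 + y\<^sup>2" by linarith
    then show ?thesis by (simp add: abs_mult)
  qed
  then show "AE t in lebesgue_I. norm (f t * g t) \<le> norm ((f t)\<^sup>2 + (g t)\<^sup>2)"
    by blast
qed

lemma L2_add:
  assumes "f \<in> L2" "g \<in> L2"
  shows "(\<lambda>t. f t + g t) \<in> L2"
  using assms L2_integrable_mult[OF assms]
  by (auto simp: L2_def power2_sum mult.assoc)

lemma L2_cmult: "f \<in> L2 \<Longrightarrow> (\<lambda>t. c * f t) \<in> L2"
  by (auto simp: L2_def power_mult_distrib)

lemma L2_diff: "f \<in> L2 \<Longrightarrow> g \<in> L2 \<Longrightarrow> (\<lambda>t. f t - g t) \<in> L2"
  using L2_add[of f "\<lambda>t. (-1) * g t"] L2_cmult[of g "-1"] by simp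

lemma L2_zero: "(\<lambda>t. 0) \<in> L2"
  by (simp add: L2_def)

lemma L2_sum: "(\<And>k. k \<in> A \<Longrightarrow> u k \<in> L2) \<Longrightarrow> (\<lambda>t. \<Sum>k\<in>A. u k t) \<in> L2"
  by (induction A rule: infinite_finite_induct) (auto simp: L2_zero intro: L2_add)

lemma L2_continuous: "continuous_on {-1..1} f \<Longrightarrow> f \<in> L2"
  unfolding L2_def
  by (auto intro!: continuous_imp_integrable_real continuous_intros
      borel_measurable_integrable)

lemma L2_poly: "poly p \<in> L2"
  by (intro L2_continuous continuous_intros)

lemma L2_norm_nonneg: "0 \<le> L2_norm f"
  by (simp add: L2_norm_def)

lemma L2_norm_power2: "(L2_norm f)\<^sup>2 = (LINT t|lebesgue_I. (f t)\<^sup>2)"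
  by (simp add: L2_norm_def)

lemma L2_norm_zero: "L2_norm (\<lambda>t. 0) = 0"
  by (simp add: L2_norm_def)

lemma L2_norm_cmult: "L2_norm (\<lambda>t. c * f t) = \<bar>c\<bar> * L2_norm f"
  by (simp add: L2_norm_def power_mult_distrib real_sqrt_mult)

text \<open>The quadratic polynomial \<open>x \<mapsto> \<integral> (f + x g)\<^sup>2\<close> is nonnegative, hence has nonpositive discriminant.\<close>

lemma L2_Cauchy_Schwarz:
  assumes "f \<in> L2" "g \<in> L2"
  shows "(LINT t|lebesgue_I. f t * g t) \<le> L2_norm f * L2_norm g"
proof -
  define A B C where "A = (LINT t|lebesgue_I. (f t)\<^sup>2)" and "B = (LINT t|lebesgue_I. (g t)\<^sup>2)"
    and "C = (LINT t|lebesgue_I. f t * g t)"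
  have nonneg: "0 \<le> A + 2 * x * C + x\<^sup>2 * B" for x
  proof -
    have "0 \<le> (LINT t|lebesgue_I. (f t + x * g t)\<^sup>2)"
      by simp
    also have "(\<lambda>t. (f t + x * g t)\<^sup>2) = (\<lambda>t. (f t)\<^sup>2 + 2 * x * (f t * g t) + x\<^sup>2 * (g t)\<^sup>2)"
      by (auto simp: power2_eq_square algebra_simps)
    also have "(LINT t|lebesgue_I. \<dots> t) = A + 2 * x * C + x\<^sup>2 * B"
      using assms[THEN L2_integrable_square] L2_integrable_mult[OF assms]
      by (simp add: A_def B_def C_def)
    finally show ?thesis .
  qed
  have "C\<^sup>2 \<le> A * B"
  proof (cases "B = 0")
    case True
    have "C = 0"
    proof (rule ccontr)
      assume "C \<noteq> 0"
      then show False using nonneg[of "- (A + 1) / (2 * C)"] True by (simp add: field_simps)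
    qed
    then show ?thesis using True by simp
  next
    case False
    then have "B > 0" by (simp add: B_def less_le)
    then show ?thesis using nonneg[of "- C / B"]
      by (simp add: field_simps power2_eq_square)
  qed
  then have "C \<le> sqrt (A * B)"
    by (rule real_le_rsqrt)
  then show ?thesis
    by (simp add: L2_norm_def A_def B_def C_def real_sqrt_mult)
qed

lemma L2_norm_triangle:
  assumes "f \<in> L2" "g \<in> L2"
  shows "L2_norm (\<lambda>t. f t + g t) \<le> L2_norm f + L2_norm g"
proof (rule power2_le_imp_le)
  have "(L2_norm (\<lambda>t. f t + g t))\<^sup>2
      = (L2_norm f)\<^sup>2 + (L2_norm g)\<^sup>2 + 2 * (LINT t|lebesgue_I. f t * g t)"
    using assms[THEN L2_integrable_square] L2_integrable_mult[OF assms]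
    by (simp add: L2_norm_power2 power2_sum mult.assoc)
  also have "\<dots> \<le> (L2_norm f + L2_norm g)\<^sup>2"
    using L2_Cauchy_Schwarz[OF assms] by (simp add: power2_sum)
  finally show "(L2_norm (\<lambda>t. f t + g t))\<^sup>2 \<le> (L2_norm f + L2_norm g)\<^sup>2" .
qed (simp add: L2_norm_nonneg)

lemma L2_norm_sum_le:
  assumes "\<And>k. k \<in> A \<Longrightarrow> u k \<in> L2"
  shows "L2_norm (\<lambda>t. \<Sum>k\<in>A. u k t) \<le> (\<Sum>k\<in>A. L2_norm (u k))"
  using assms
proof (induction A rule: infinite_finite_induct)
  case (insert k A)
  have "L2_norm (\<lambda>t. u k t + (\<Sum>k\<in>A. u k t)) \<le> L2_norm (u k) + L2_norm (\<lambda>t. \<Sum>k\<in>A. u k t)"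
    using insert.prems by (intro L2_norm_triangle L2_sum) auto
  then show ?case using insert by fastforce
qed (simp_all add: L2_norm_zero)

lemma nn_integral_L2_square:
  "f \<in> L2 \<Longrightarrow> (\<integral>\<^sup>+t. ennreal ((f t)\<^sup>2) \<partial>lebesgue_I) = ennreal ((L2_norm f)\<^sup>2)"
  by (simp add: L2_norm_power2 nn_integral_eq_integral L2_integrable_square)

text \<open>On an interval of finite length the \<open>L\<^sub>2\<close> norm dominates the \<open>L\<^sub>1\<close> norm (Cauchy-Schwarz
  against the constant 1), so the sum of the \<open>\<bar>u n\<bar>\<close> has a finite integral and is therefore finite
  almost everywhere.\<close>

lemma AE_summable_of_summable_L2_norm:
  assumes u: "\<And>n. u n \<in> L2" and summ: "summable (\<lambda>n. L2_norm (u n))"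
  shows "AE t in lebesgue_I. summable (\<lambda>n. u n t)"
proof -
  have [measurable]: "u n \<in> borel_measurable lebesgue_I" for n
    using u by (rule L2_measurable)
  have one: "(\<lambda>t. 1) \<in> L2" by (simp add: L2_continuous)
  have absu: "(\<lambda>t. \<bar>u n t\<bar>) \<in> L2" for n
    using u[of n] by (simp add: L2_def)
  have int: "integrable lebesgue_I (\<lambda>t. \<bar>u n t\<bar>)" for n
    using L2_integrable_mult[OF absu one] by simp
  let ?c = "L2_norm (\<lambda>t. 1)"
  have "(\<integral>\<^sup>+t. (\<Sum>n. ennreal \<bar>u n t\<bar>) \<partial>lebesgue_I) = (\<Sum>n. \<integral>\<^sup>+t. ennreal \<bar>u n t\<bar> \<partial>lebesgue_I)"
    by (rule nn_integral_suminf) measurable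
  also have "\<dots> \<le> (\<Sum>n. ennreal (?c * L2_norm (u n)))"
  proof (intro suminf_le summableI)
    fix n
    have "(\<integral>\<^sup>+t. ennreal \<bar>u n t\<bar> \<partial>lebesgue_I) = ennreal (LINT t|lebesgue_I. \<bar>u n t\<bar>)"
      using int by (intro nn_integral_eq_integral) auto
    also have "(LINT t|lebesgue_I. \<bar>u n t\<bar>) \<le> ?c * L2_norm (u n)"
      using L2_Cauchy_Schwarz[OF absu one, of n] by (simp add: L2_norm_def mult.commute)
    finally show "(\<integral>\<^sup>+t. ennreal \<bar>u n t\<bar> \<partial>lebesgue_I) \<le> ennreal (?c * L2_norm (u n))"
      by (simp add: ennreal_leI)
  qed
  also have "\<dots> = ennreal (\<Sum>n. ?c * L2_norm (u n))"
    using summ by (intro suminf_ennreal2 summable_mult) (auto simp: L2_norm_nonneg)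
  finally have "(\<integral>\<^sup>+t. (\<Sum>n. ennreal \<bar>u n t\<bar>) \<partial>lebesgue_I) \<noteq> \<infinity>"
    by (auto simp: top_unique)
  then have "AE t in lebesgue_I. (\<Sum>n. ennreal \<bar>u n t\<bar>) \<noteq> \<infinity>"
    by (intro nn_integral_PInf_AE) auto
  then show ?thesis
    by eventually_elim (simp add: summable_rabs_cancel summable_suminf_not_top)
qed

text \<open>The form of completeness of \<open>L\<^sub>2\<close> that the existence of the derivative rests on. The limit is the
  pointwise sum, which exists almost everywhere; applying Fatou's lemma to the partial sums bounds
  the remainder after \<open>n\<close> terms by the tail of the series of norms.\<close>

lemma L2_series_converges:
  assumes u: "\<And>n. u n \<in> L2" and summ: "summable (\<lambda>n. L2_norm (u n))"
  obtains g where "g \<in> L2" "(\<lambda>n. L2_norm (\<lambda>t. g t - (\<Sum>k<n. u k t))) \<longlonglongrightarrow> 0"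
proof
  have [measurable]: "u n \<in> borel_measurable lebesgue_I" for n
    using u by (rule L2_measurable)
  \<comment> \<open>On the null set where the series diverges, \<open>suminf\<close> has an unspecified value, which is harmless.\<close>
  define g where "g t = (\<Sum>n. u n t)" for t
  have [measurable]: "g \<in> borel_measurable lebesgue_I"
    unfolding g_def by measurable
  define T where "T n = (\<Sum>k. L2_norm (u (k + n)))" for n
  have T_nonneg: "0 \<le> T n" for n
    unfolding T_def
    by (intro suminf_nonneg) (auto simp: L2_norm_nonneg summable_ignore_initial_segment[OF summ, of n])
  have bound: "(\<integral>\<^sup>+t. ennreal ((g t - (\<Sum>k<n. u k t))\<^sup>2) \<partial>lebesgue_I) \<le> ennreal ((T n)\<^sup>2)" for n
  proof -
    let ?S = "\<lambda>m t. (\<Sum>k<m. u (k + n) t)"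
    have "AE t in lebesgue_I. ennreal ((g t - (\<Sum>k<n. u k t))\<^sup>2) = liminf (\<lambda>m. ennreal ((?S m t)\<^sup>2))"
      using AE_summable_of_summable_L2_norm[OF assms]
    proof eventually_elim
      case (elim t)
      have "(\<lambda>k. u (k + n) t) sums (g t - (\<Sum>k<n. u k t))"
        unfolding g_def using elim by (intro sums_split_initial_segment) (rule summable_sums)
      then have "(\<lambda>m. ennreal ((?S m t)\<^sup>2)) \<longlonglongrightarrow> ennreal ((g t - (\<Sum>k<n. u k t))\<^sup>2)"
        unfolding sums_def by (intro tendsto_intros)
      then show ?case by (rule lim_imp_Liminf[OF trivial_limit_sequentially, symmetric])
    qed
    then have "(\<integral>\<^sup>+t. ennreal ((g t - (\<Sum>k<n. u k t))\<^sup>2) \<partial>lebesgue_I)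
        = (\<integral>\<^sup>+t. liminf (\<lambda>m. ennreal ((?S m t)\<^sup>2)) \<partial>lebesgue_I)"
      by (rule nn_integral_cong_AE)
    also have "\<dots> \<le> liminf (\<lambda>m. \<integral>\<^sup>+t. ennreal ((?S m t)\<^sup>2) \<partial>lebesgue_I)"
      by (rule nn_integral_liminf) measurable
    also have "\<dots> \<le> ennreal ((T n)\<^sup>2)"
    proof (rule Liminf_le)
      have "(\<integral>\<^sup>+t. ennreal ((?S m t)\<^sup>2) \<partial>lebesgue_I) \<le> ennreal ((T n)\<^sup>2)" for m
      proof -
        have "L2_norm (?S m) \<le> (\<Sum>k<m. L2_norm (u (k + n)))"
          by (intro L2_norm_sum_le u)
        also have "\<dots> \<le> T n"
          unfolding T_def
          by (intro sum_le_suminf) (auto simp: L2_norm_nonneg summable_ignore_initial_segment[OF summ, of n])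
        finally show ?thesis
          by (simp add: nn_integral_L2_square L2_sum u ennreal_leI power_mono L2_norm_nonneg)
      qed
      then show "\<forall>\<^sub>F m in sequentially. (\<integral>\<^sup>+t. ennreal ((?S m t)\<^sup>2) \<partial>lebesgue_I) \<le> ennreal ((T n)\<^sup>2)"
        by simp
    qed simp
    finally show ?thesis .
  qed
  show gL2: "g \<in> L2"
  proof -
    have "(\<integral>\<^sup>+t. ennreal ((g t)\<^sup>2) \<partial>lebesgue_I) < \<infinity>"
      using bound[of 0] by (simp add: le_less_trans)
    then show ?thesis
      unfolding L2_def by (auto intro!: integrableI_nonneg)
  qed
  have le_T: "L2_norm (\<lambda>t. g t - (\<Sum>k<n. u k t)) \<le> T n" for n
  proof -
    have "(\<lambda>t. g t - (\<Sum>k<n. u k t)) \<in> L2"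
      by (intro L2_diff gL2 L2_sum u)
    from nn_integral_L2_square[OF this] bound[of n]
    have "ennreal ((L2_norm (\<lambda>t. g t - (\<Sum>k<n. u k t)))\<^sup>2) \<le> ennreal ((T n)\<^sup>2)"
      by simp
    then have "(L2_norm (\<lambda>t. g t - (\<Sum>k<n. u k t)))\<^sup>2 \<le> (T n)\<^sup>2"
      by (subst (asm) ennreal_le_iff) simp_all
    then show ?thesis
      using T_nonneg by (rule power2_le_imp_le)
  qed
  show "(\<lambda>n. L2_norm (\<lambda>t. g t - (\<Sum>k<n. u k t))) \<longlonglongrightarrow> 0"
  proof (rule Lim_null_comparison)
    show "\<forall>\<^sub>F n in sequentially. norm (L2_norm (\<lambda>t. g t - (\<Sum>k<n. u k t))) \<le> T n"
      using le_T by (simp add: L2_norm_nonneg)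
    show "T \<longlonglongrightarrow> 0"
      unfolding T_def[abs_def] by (rule suminf_exist_split2[OF summ])
  qed
qed

section \<open>Norms of derivatives of Legendre polynomials\<close>

text \<open>The Legendre polynomial \<open>P\<^sub>k\<close> in its classical normalisation \<open>P\<^sub>k(1) = 1\<close>, given by Rodrigues'
  formula. It is more convenient than the orthonormal one, because its derivatives satisfy a
  recursion with integer coefficients and its values at the endpoints are \<open>\<plusminus>1\<close>.\<close>

definition rodrigues :: "nat \<Rightarrow> real poly" where
  "rodrigues k = smult (1 / (2 ^ k * fact k)) ((pderiv ^^ k) ([:-1, 0, 1:] ^ k))"

lemma legendre_eq_rodrigues: "legendre k = smult (sqrt (real k + 1/2)) (rodrigues k)"
  by (simp add: legendre_def rodrigues_def)

lemma degree_rodrigues_le: "degree (rodrigues k) \<le> k"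
proof -
  have "degree ([:-1, 0, 1::real:] ^ k) \<le> 2 * k"
    using degree_power_le[of "[:-1, 0, 1::real:]" k] by (simp add: mult.commute)
  then show ?thesis
    by (simp add: rodrigues_def degree_higher_pderiv)
qed

lemma pderiv_square_minus_one_power:
  "pderiv ([:-1, 0, 1::real:] ^ Suc k) = smult (2 * real (Suc k)) ([:0, 1:] * [:-1, 0, 1:] ^ k)"
proof -
  have "pderiv [:-1, 0, 1::real:] = smult 2 [:0, 1:]"
    by (simp add: pderiv_pCons)
  then show ?thesis
    by (simp only: pderiv_power_Suc) (simp add: algebra_simps)
qed

lemma pderiv2_square_minus_one_power:
  "pderiv (pderiv ([:-1, 0, 1::real:] ^ Suc (Suc k))) =
     smult (2 * real (Suc (Suc k))) (smult (2 * real k + 3) ([:-1, 0, 1:] ^ Suc k)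
       + smult (2 * real (Suc k)) ([:-1, 0, 1:] ^ k))"
proof -
  let ?u = "[:-1, 0, 1::real:]"
  have X2: "[:0, 1:] * [:0, 1:] = ?u + 1"
    by (simp add: one_pCons)
  have "pderiv ([:0, 1:] * ?u ^ Suc k)
      = smult (2 * real (Suc k)) (([:0, 1:] * [:0, 1:]) * ?u ^ k) + ?u ^ Suc k"
    by (simp only: pderiv_mult pderiv_square_minus_one_power)
       (simp add: pderiv_pCons one_pCons algebra_simps)
  also have "\<dots> = smult (2 * real (Suc k) + 1) (?u ^ Suc k) + smult (2 * real (Suc k)) (?u ^ k)"
  proof -
    have "smult a ((U + 1) * V) + U * V = smult (a + 1) (U * V) + smult a V"
      for a :: real and U V
      by (simp add: distrib_right smult_add_left smult_add_right)
    then show ?thesis unfolding X2 power_Suc .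
  qed
  also have "2 * real (Suc k) + 1 = 2 * real k + 3"
    by simp
  finally show ?thesis
    by (simp only: pderiv_square_minus_one_power[of "Suc k"] pderiv_smult)
qed

text \<open>Differentiate the previous identity \<open>k + 1\<close> times. The recursion is the engine of the estimates
  below, since it trades a derivative of a Legendre polynomial for a derivative of lower order and
  polynomials of lower degree.\<close>

lemma pderiv_rodrigues_Suc_Suc:
  "pderiv (rodrigues (Suc (Suc k))) = smult (2 * real k + 3) (rodrigues (Suc k)) + pderiv (rodrigues k)"
proof -
  let ?u = "[:-1, 0, 1::real:]"
  have "(pderiv ^^ Suc (Suc (Suc k))) (?u ^ Suc (Suc k))
      = (pderiv ^^ Suc k) (pderiv (pderiv (?u ^ Suc (Suc k))))"
    by (simp only: funpow_Suc_right o_apply)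
  also have "\<dots> = smult (2 * real (Suc (Suc k))) (smult (2 * real k + 3) ((pderiv ^^ Suc k) (?u ^ Suc k))
       + smult (2 * real (Suc k)) ((pderiv ^^ Suc k) (?u ^ k)))"
    by (simp only: pderiv2_square_minus_one_power higher_pderiv_smult higher_pderiv_add)
  finally have *: "pderiv ((pderiv ^^ Suc (Suc k)) (?u ^ Suc (Suc k))) = smult (2 * real (Suc (Suc k))) (smult (2 * real k + 3) ((pderiv ^^ Suc k) (?u ^ Suc k))
       + smult (2 * real (Suc k)) ((pderiv ^^ Suc k) (?u ^ k)))"
    by simp
  have c: "1 / (2 ^ Suc (Suc k) * fact (Suc (Suc k))) * (2 * real (Suc (Suc k)))
         = 1 / (2 ^ Suc k * fact (Suc k))"
    "1 / (2 ^ Suc k * fact (Suc k)) * (2 * real (Suc k)) = (1 / (2 ^ k * fact k) :: real)"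
    by (simp_all add: divide_simps del: of_nat_Suc)
  let ?A = "(pderiv ^^ Suc k) (?u ^ Suc k)" and ?B = "(pderiv ^^ Suc k) (?u ^ k)"
  have "pderiv (rodrigues (Suc (Suc k)))
      = smult (1 / (2 ^ Suc k * fact (Suc k))) (smult (2 * real k + 3) ?A + smult (2 * real (Suc k)) ?B)"
    by (simp only: rodrigues_def pderiv_smult * smult_smult c(1))
  also have "\<dots> = smult (2 * real k + 3) (smult (1 / (2 ^ Suc k * fact (Suc k))) ?A)
      + smult (1 / (2 ^ k * fact k)) ?B"
    by (simp only: smult_add_right smult_smult c(2) mult.commute[of "2 * real k + 3"])
  also have "\<dots> = smult (2 * real k + 3) (rodrigues (Suc k)) + pderiv (rodrigues k)"
    by (simp only: rodrigues_def pderiv_smult funpow.simps o_apply)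
  finally show ?thesis .
qed

lemma power_dvd_pderiv:
  fixes l q :: "real poly"
  assumes "l ^ Suc m dvd q"
  shows "l ^ m dvd pderiv q"
proof -
  obtain w where "q = l ^ Suc m * w" using assms by (elim dvdE)
  then have "pderiv q = l ^ m * (l * pderiv w + smult (real (Suc m)) (w * pderiv l))"
    by (simp only: pderiv_mult pderiv_power_Suc) (simp add: algebra_simps)
  then show ?thesis by simp
qed

lemma root_higher_pderiv:
  fixes q :: "real poly"
  assumes "[:-x, 1:] ^ k dvd q" "j < k"
  shows "poly ((pderiv ^^ j) q) x = 0"
proof -
  have "[:-x, 1:] ^ (k - j) dvd (pderiv ^^ j) q" if "j \<le> k" for j
    using that
  proof (induction j)
    case (Suc j)
    then show ?case
      using power_dvd_pderiv[of "[:-x, 1:]" "k - Suc j" "(pderiv ^^ j) q"]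
      by (simp add: Suc_diff_Suc del: power_Suc)
  qed (use assms in simp)
  from this[of j] assms(2) have "[:-x, 1:] dvd (pderiv ^^ j) q"
    by (meson dvd_power dvd_trans less_imp_le_nat zero_less_diff)
  then show ?thesis
    by (simp add: poly_eq_0_iff_dvd)
qed

text \<open>At both endpoints \<open>(x\<^sup>2 - 1)\<^sup>k\<close> has a zero of order \<open>k\<close>. This kills the boundary terms in the
  integrations by parts below; writing the endpoints as the solutions of \<open>x\<^sup>2 = 1\<close> treats them
  together.\<close>

lemma square_minus_one_power_root:
  assumes "x\<^sup>2 = 1" "j < k"
  shows "poly ((pderiv ^^ j) ([:-1, 0, 1:] ^ k)) x = (0::real)"
proof (rule root_higher_pderiv[OF _ assms(2)])
  have "[:-1, 0, 1:] = [:-x, 1:] * [:x, 1:]"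
    using assms(1) by (simp add: power2_eq_square)
  then show "[:-x, 1:] ^ k dvd [:-1, 0, 1:] ^ k"
    by (simp add: power_mult_distrib del: mult_pCons_left mult_pCons_right)
qed

lemma higher_pderiv_X_mult:
  "(pderiv ^^ Suc k) ([:0, 1:] * q) = [:0, 1:] * (pderiv ^^ Suc k) q + smult (real (Suc k)) ((pderiv ^^ k) q)"
proof (induction k)
  case 0
  show ?case by (simp add: pderiv_pCons algebra_simps)
next
  case (Suc k)
  have "(pderiv ^^ Suc (Suc k)) ([:0, 1:] * q) = pderiv ((pderiv ^^ Suc k) ([:0, 1:] * q))"
    by simp
  also have "\<dots> = [:0, 1:] * (pderiv ^^ Suc (Suc k)) q + smult (real (Suc (Suc k))) ((pderiv ^^ Suc k) q)"
  proof -
    have "real (Suc (Suc k)) = 1 + real (Suc k)" by simp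
    then show ?thesis
      unfolding Suc pderiv_add pderiv_mult pderiv_smult
      by (simp only: smult_add_left) (simp add: pderiv_pCons one_pCons[symmetric] del: of_nat_Suc)
  qed
  finally show ?case .
qed

text \<open>Since \<open>D (x\<^sup>2 - 1)\<^sup>k\<^sup>+\<^sup>1\<close> is a multiple of \<open>x (x\<^sup>2 - 1)\<^sup>k\<close>, the Leibniz rule gives
  \<open>x P\<^sub>k\<close> plus a multiple of a derivative of \<open>(x\<^sup>2 - 1)\<^sup>k\<close> of order below \<open>k\<close>, and the latter vanishes
  at the endpoints.\<close>

lemma poly_rodrigues_Suc_endpoint:
  assumes "x\<^sup>2 = (1::real)"
  shows "poly (rodrigues (Suc k)) x = x * poly (rodrigues k) x"
proof -
  let ?u = "[:-1, 0, 1::real:]"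
  have "poly ((pderiv ^^ k) ([:0, 1:] * ?u ^ k)) x = x * poly ((pderiv ^^ k) (?u ^ k)) x"
  proof (cases k)
    case (Suc j)
    show ?thesis
      unfolding Suc higher_pderiv_X_mult using square_minus_one_power_root[OF assms, of j "Suc j"]
      by (simp del: funpow.simps power_Suc)
  qed simp
  moreover have "rodrigues (Suc k) = smult (1 / (2 ^ k * fact k)) ((pderiv ^^ k) ([:0, 1:] * ?u ^ k))"
    unfolding rodrigues_def funpow_Suc_right o_apply pderiv_square_minus_one_power
      higher_pderiv_smult smult_smult
    by (simp add: divide_simps del: of_nat_Suc)
  ultimately show ?thesis by (simp add: rodrigues_def)
qed

lemma abs_poly_rodrigues_endpoint:
  assumes "x\<^sup>2 = (1::real)"
  shows "\<bar>poly (rodrigues k) x\<bar> = 1"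
proof (induction k)
  case (Suc k)
  have "\<bar>x\<bar> = 1" using assms by (simp add: abs_square_eq_1)
  with Suc show ?case by (simp add: poly_rodrigues_Suc_endpoint[OF assms] abs_mult)
qed (simp add: rodrigues_def)

lemma rodrigues_0: "rodrigues 0 = 1"
  by (simp add: rodrigues_def)

lemma rodrigues_1: "rodrigues (Suc 0) = [:0, 1:]"
  by (simp add: rodrigues_def pderiv_pCons)

lemma abs_poly_pderiv_rodrigues_endpoint:
  assumes "x\<^sup>2 = (1::real)"
  shows "\<bar>poly (pderiv (rodrigues k)) x\<bar> \<le> real k * (real k + 1) / 2"
proof (induction k rule: induct_nat_012)
  case (ge2 k)
  have "\<bar>poly (pderiv (rodrigues (Suc (Suc k)))) x\<bar>
    \<le> (2 * real k + 3) * \<bar>poly (rodrigues (Suc k)) x\<bar> + \<bar>poly (pderiv (rodrigues k)) x\<bar>"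
    unfolding pderiv_rodrigues_Suc_Suc using abs_triangle_ineq
    by (simp add: abs_mult order_trans[OF abs_triangle_ineq])
  with ge2 show ?case
    by (simp add: abs_poly_rodrigues_endpoint[OF assms] field_simps)
qed (simp_all add: rodrigues_0 rodrigues_1 pderiv_pCons)

lemma integrable_poly: "integrable lebesgue_I (poly p)"
  by (rule continuous_imp_integrable_real) (intro continuous_intros)

lemma integral_pderiv: "(LINT t|lebesgue_I. poly (pderiv p) t) = poly p 1 - poly p (-1)"
proof -
  have "((poly (pderiv p)) has_integral (poly p 1 - poly p (-1))) {-1..1}"
  proof (rule fundamental_theorem_of_calculus)
    fix x :: real
    show "(poly p has_vector_derivative poly (pderiv p) x) (at x within {-1..1})"
      unfolding has_real_derivative_iff_has_vector_derivative[symmetric]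
      by (rule DERIV_subset[OF poly_DERIV subset_UNIV])
  qed simp
  then show ?thesis
    by (simp add: lebesgue_integral_eq_integral integrable_poly integral_unique)
qed

lemma integral_by_parts_poly:
  "(LINT t|lebesgue_I. poly (pderiv p * q) t)
     = poly (p * q) 1 - poly (p * q) (-1) - (LINT t|lebesgue_I. poly (p * pderiv q) t)"
proof -
  have "poly (p * q) 1 - poly (p * q) (-1) = (LINT t|lebesgue_I. poly (pderiv p * q) t + poly (p * pderiv q) t)"
  proof -
    have "poly (pderiv (p * q)) t = poly (pderiv p * q) t + poly (p * pderiv q) t" for t
      by (simp add: pderiv_mult)
    then show ?thesis by (simp only: integral_pderiv[symmetric])
  qed
  also have "\<dots> = (LINT t|lebesgue_I. poly (pderiv p * q) t) + (LINT t|lebesgue_I. poly (p * pderiv q) t)"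
    by (intro Bochner_Integration.integral_add integrable_poly)
  finally show ?thesis by simp
qed

text \<open>Integrate by parts repeatedly: derivatives move to \<open>q\<close>, whose degree is too small to survive, and
  every boundary term contains a derivative of \<open>(x\<^sup>2 - 1)\<^sup>k\<close> of order below \<open>k\<close>.\<close>

lemma integral_higher_pderiv_eq_0:
  assumes "j \<le> k" "degree q < j"
  shows "(LINT t|lebesgue_I. poly ((pderiv ^^ j) ([:-1, 0, 1:] ^ k) * q) t) = 0"
  using assms
proof (induction j arbitrary: q)
  case (Suc j)
  let ?v = "(pderiv ^^ j) ([:-1, 0, 1:] ^ k) :: real poly"
  have "poly ?v 1 = 0" "poly ?v (-1) = 0"
    using Suc.prems by (simp_all add: square_minus_one_power_root)
  moreover have "(LINT t|lebesgue_I. poly (?v * pderiv q) t) = 0"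
  proof (cases "degree q = 0")
    case True
    then have "pderiv q = 0" by (simp add: pderiv_eq_0_iff)
    then show ?thesis by simp
  next
    case False
    then show ?thesis using Suc.prems by (intro Suc.IH) (auto simp: degree_pderiv)
  qed
  ultimately show ?case
    using integral_by_parts_poly[of ?v q] by simp
qed simp

lemma rodrigues_orthogonal:
  assumes "degree q < k"
  shows "(LINT t|lebesgue_I. poly (rodrigues k * q) t) = 0"
  using integral_higher_pderiv_eq_0[OF order.refl assms] by (simp add: rodrigues_def)

lemma L2_norm_poly_0: "L2_norm (poly 0) = 0"
  by (simp add: L2_norm_def)

text \<open>Integration by parts turns \<open>\<integral> P'\<^sub>k P'\<^sub>k\<close> into boundary values, because \<open>P''\<^sub>k\<close> has degree below \<open>k\<close>
  and is orthogonal to \<open>P\<^sub>k\<close>. Orthogonality is what makes the first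
  derivative sharp: summing the recursion with the triangle inequality would lose a factor
  \<open>k\<^sup>1\<^sup>/\<^sup>2\<close>.\<close>

lemma L2_norm_pderiv_rodrigues_power2:
  "(L2_norm (poly (pderiv (rodrigues k))))\<^sup>2 \<le> real k * (real k + 1)"
proof (cases "k = 0")
  case True
  then show ?thesis by (simp add: rodrigues_0 L2_norm_poly_0)
next
  case False
  let ?p = "rodrigues k"
  let ?b = "real k * (real k + 1) / 2"
  have "degree (pderiv (pderiv ?p)) < k"
    using False degree_rodrigues_le[of k] by (simp add: degree_pderiv)
  then have "(L2_norm (poly (pderiv ?p)))\<^sup>2
     = poly (?p * pderiv ?p) 1 - poly (?p * pderiv ?p) (-1)"
    using integral_by_parts_poly[of ?p "pderiv ?p"] rodrigues_orthogonal[of "pderiv (pderiv ?p)" k]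
    unfolding L2_norm_power2 by (simp add: power2_eq_square)
  also have "\<dots> \<le> \<bar>poly (?p * pderiv ?p) 1\<bar> + \<bar>poly (?p * pderiv ?p) (-1)\<bar>"
    by linarith
  also have "\<dots> \<le> ?b + ?b"
    using abs_poly_pderiv_rodrigues_endpoint[of 1 k] abs_poly_pderiv_rodrigues_endpoint[of "-1" k]
    by (intro add_mono) (simp_all add: abs_mult abs_poly_rodrigues_endpoint)
  finally show ?thesis by simp
qed

text \<open>From the second derivative on nothing is lost by the triangle inequality: unrolling the recursion
  gives at most \<open>k\<close> terms, each at most \<open>2k\<close> times the bound for one derivative less, so each
  derivative costs a factor \<open>2 k\<^sup>2\<close>.\<close>

lemma L2_norm_higher_pderiv_rodrigues:
  "L2_norm (poly ((pderiv ^^ Suc r) (rodrigues k))) \<le> 2 ^ Suc r * real k ^ (2 * r + 1)"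
proof (induction r arbitrary: k)
  case 0
  have "(L2_norm (poly (pderiv (rodrigues k))))\<^sup>2 \<le> (2 * real k)\<^sup>2"
  proof (cases "k = 0")
    case True
    then show ?thesis using L2_norm_pderiv_rodrigues_power2[of k] by simp
  next
    case False
    then have "real k * (real k + 1) \<le> (2 * real k)\<^sup>2"
      by (simp add: power2_eq_square algebra_simps)
    then show ?thesis using L2_norm_pderiv_rodrigues_power2[of k] by linarith
  qed
  then have "L2_norm (poly (pderiv (rodrigues k))) \<le> 2 * real k"
    by (rule power2_le_imp_le) simp
  then show ?case by simp
next
  case (Suc r)
  let ?N = "\<lambda>r k. L2_norm (poly ((pderiv ^^ r) (rodrigues k)))"
  show ?case
  proof (induction k rule: induct_nat_012)
    case 0
    show ?case by (simp add: rodrigues_0 L2_norm_poly_0 L2_norm_zero funpow_Suc_right del: funpow.simps)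
  next
    case 1
    show ?case
      by (simp add: rodrigues_1 pderiv_pCons L2_norm_poly_0 L2_norm_zero funpow_Suc_right del: funpow.simps)
  next
    case (ge2 k)
    let ?x = "real (Suc (Suc k))"
    have "(pderiv ^^ Suc (Suc r)) (rodrigues (Suc (Suc k)))
        = (pderiv ^^ Suc r) (pderiv (rodrigues (Suc (Suc k))))"
      by (simp only: funpow_Suc_right o_apply)
    also have "\<dots> = smult (2 * real k + 3) ((pderiv ^^ Suc r) (rodrigues (Suc k)))
        + (pderiv ^^ Suc (Suc r)) (rodrigues k)"
      by (simp only: pderiv_rodrigues_Suc_Suc pderiv_add pderiv_smult
          higher_pderiv_add higher_pderiv_smult
          funpow_Suc_right o_apply)
    finally have eq: "poly ((pderiv ^^ Suc (Suc r)) (rodrigues (Suc (Suc k))))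
        = (\<lambda>t. (2 * real k + 3) * poly ((pderiv ^^ Suc r) (rodrigues (Suc k))) t
             + poly ((pderiv ^^ Suc (Suc r)) (rodrigues k)) t)"
      by (simp add: fun_eq_iff)
    have "?N (Suc (Suc r)) (Suc (Suc k))
        \<le> (2 * real k + 3) * ?N (Suc r) (Suc k) + ?N (Suc (Suc r)) k"
      unfolding eq
      by (rule order_trans[OF L2_norm_triangle]) (simp_all add: L2_norm_cmult L2_poly L2_cmult del: funpow.simps)
    also have "\<dots> \<le> (2 * ?x) * (2 ^ Suc r * ?x ^ (2 * r + 1)) + 2 ^ Suc (Suc r) * (real k * ?x ^ (2 * r + 2))"
    proof (intro add_mono mult_mono)
      have "?N (Suc r) (Suc k) \<le> 2 ^ Suc r * real (Suc k) ^ (2 * r + 1)"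
        by (rule Suc.IH)
      also have "\<dots> \<le> 2 ^ Suc r * ?x ^ (2 * r + 1)"
        by (intro mult_left_mono power_mono) auto
      finally show "?N (Suc r) (Suc k) \<le> 2 ^ Suc r * ?x ^ (2 * r + 1)" .
      have "?N (Suc (Suc r)) k \<le> 2 ^ Suc (Suc r) * (real k * real k ^ (2 * r + 2))"
        using ge2.IH(1) by (simp add: mult.assoc)
      also have "\<dots> \<le> 2 ^ Suc (Suc r) * (real k * ?x ^ (2 * r + 2))"
        by (intro mult_left_mono power_mono) auto
      finally show "?N (Suc (Suc r)) k \<le> 2 ^ Suc (Suc r) * (real k * ?x ^ (2 * r + 2))" .
    qed (simp_all add: L2_norm_nonneg)
    also have "\<dots> = 2 ^ Suc (Suc r) * ((real k + 1) * ?x ^ (2 * r + 2))"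
      by (simp add: algebra_simps)
    also have "\<dots> \<le> 2 ^ Suc (Suc r) * (?x * ?x ^ (2 * r + 2))"
      by (intro mult_left_mono mult_right_mono) auto
    finally show ?case by (simp add: mult.assoc)
  qed
qed

text \<open>The normalising factor \<open>sqrt (k + 1/2)\<close> of the orthonormal polynomials adds a half to the exponent
  \<open>2 r - 1\<close>.\<close>

lemma L2_norm_legendre_deriv:
  assumes "r \<ge> 1" "k \<ge> 1"
  shows "L2_norm (legendre_deriv r k) \<le> 2 ^ Suc r * real k powr (2 * real r - 1/2)"
proof -
  obtain j where j: "r = Suc j" using assms(1) by (cases r) auto
  have "legendre_deriv r k = (\<lambda>t. sqrt (real k + 1/2) * poly ((pderiv ^^ Suc j) (rodrigues k)) t)"
    by (simp add: fun_eq_iff legendre_deriv_def legendre_eq_rodrigues higher_pderiv_smult j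
      del: funpow.simps)
  then have "L2_norm (legendre_deriv r k)
      = sqrt (real k + 1/2) * L2_norm (poly ((pderiv ^^ Suc j) (rodrigues k)))"
    by (simp add: L2_norm_cmult del: funpow.simps)
  also have "\<dots> \<le> (2 * real k powr (1/2)) * (2 ^ r * real k powr (2 * real r - 1))"
  proof (intro mult_mono)
    have "real k + 1/2 \<le> 4 * real k" using assms(2) by simp
    then have "sqrt (real k + 1/2) \<le> sqrt (4 * real k)" by (rule real_sqrt_le_mono)
    then show "sqrt (real k + 1/2) \<le> 2 * real k powr (1/2)"
      by (simp add: real_sqrt_mult powr_half_sqrt)
    have "real k powr (2 * real r - 1) = real k powr real (2 * j + 1)"
      by (simp add: j)
    also have "\<dots> = real k ^ (2 * j + 1)"
      using assms(2) by (intro powr_realpow) simp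
    finally have "real k powr (2 * real r - 1) = real k ^ (2 * j + 1)" .
    then show "L2_norm (poly ((pderiv ^^ Suc j) (rodrigues k)))
        \<le> 2 ^ r * real k powr (2 * real r - 1)"
      using L2_norm_higher_pderiv_rodrigues[of j k] by (simp only: j)
  qed (simp_all add: L2_norm_nonneg)
  also have "\<dots> = 2 ^ Suc r * (real k powr (1/2) * real k powr (2 * real r - 1))"
    by simp
  also have "real k powr (1/2) * real k powr (2 * real r - 1) = real k powr (2 * real r - 1/2)"
    by (simp flip: powr_add)
  finally show ?thesis .
qed

section \<open>Weighted sums\<close>

text \<open>Young's inequality, in a form that covers \<open>s = 1\<close> uniformly: the conjugate exponent, which would be
  infinite there, does not appear. Summed over an index with suitable \<open>y\<close>, it takes the place of
  Hoelder's inequality.\<close>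

lemma Young_sum_bound:
  fixes x y s :: real
  assumes "0 \<le> x" "0 < y" "1 \<le> s"
  shows "x * y powr (1 - 1/s) \<le> x powr s + y"
proof (cases "x = 0")
  case False
  have "(x powr s) powr (1/s) * y powr (1 - 1/s) \<le> 1/s * x powr s + (1 - 1/s) * y"
    using assms False by (intro Youngs_inequality_0) (auto simp: field_simps)
  moreover have "(x powr s) powr (1/s) = x"
    using assms by (simp add: powr_powr)
  moreover have "1/s * x powr s \<le> 1 * x powr s" "(1 - 1/s) * y \<le> 1 * y"
    using assms by (intro mult_right_mono; simp add: field_simps)+
  ultimately show ?thesis by simp
qed (use assms in simp)

text \<open>Bernoulli's inequality \<open>(1 - 1/x) powr (-\<beta>) \<ge> 1 + \<beta>/x\<close>, multiplied by \<open>x powr (-\<beta>)\<close>.\<close>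

lemma powr_telescope_bound:
  fixes \<beta> x :: real
  assumes "\<beta> > 0" "x > 1"
  shows "\<beta> * x powr (-1 - \<beta>) \<le> (x - 1) powr (-\<beta>) - x powr (-\<beta>)"
proof -
  have "ln (1 - 1/x) \<le> - (1/x)"
    using ln_le_minus_one[of "1 - 1/x"] assms by simp
  then have "\<beta> * (1/x) \<le> -\<beta> * ln (1 - 1/x)"
    using mult_left_mono[of "ln (1 - 1/x)" "- (1/x)" \<beta>] assms(1) by simp
  then have "exp (\<beta> * (1/x)) \<le> (1 - 1/x) powr (-\<beta>)"
    using assms by (simp add: powr_def)
  then have "1 + \<beta> * (1/x) \<le> (1 - 1/x) powr (-\<beta>)"
    using exp_ge_add_one_self[of "\<beta> * (1/x)"] by linarith
  then have "1 + \<beta> / x \<le> (1 - 1/x) powr (-\<beta>)"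
    by simp
  then have "x powr (-\<beta>) * (1 + \<beta> / x) \<le> x powr (-\<beta>) * (1 - 1/x) powr (-\<beta>)"
    by (intro mult_left_mono) auto
  also have "\<dots> = (x * (1 - 1/x)) powr (-\<beta>)"
    using assms by (subst powr_mult) auto
  also have "x * (1 - 1/x) = x - 1"
    using assms by (simp add: field_simps)
  finally show ?thesis
    using assms by (simp add: powr_diff powr_minus field_simps)
qed

lemma sum_powr_tail_le:
  fixes \<beta> :: real
  assumes "\<beta> > 0" "N \<ge> 1"
  shows "(\<Sum>k=Suc N..n. real k powr (-1 - \<beta>)) \<le> real N powr (-\<beta>) / \<beta>"
proof -
  have "\<beta> * (\<Sum>k=Suc N..n. real k powr (-1 - \<beta>)) \<le> real N powr (-\<beta>) - real (max N n) powr (-\<beta>)"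
  proof (induction n)
    case (Suc n)
    show ?case
    proof (cases "N \<le> n")
      case True
      with Suc powr_telescope_bound[OF assms(1), of "real (Suc n)"] assms(2)
      show ?thesis by (simp add: distrib_left max_def split: if_splits)
    next
      case False
      then show ?thesis by simp
    qed
  qed simp
  also have "\<dots> \<le> real N powr (-\<beta>)" by simp
  finally show ?thesis using assms by (simp add: field_simps)
qed

text \<open>Hoelder's inequality with exponent \<open>s\<close> for the product of \<open>k powr \<mu> * b k\<close> and
  \<open>k powr (a - \<mu>)\<close>; the condition \<open>\<beta> > 0\<close> puts the second factor into the dual sequence
  space.\<close>

lemma weighted_tail_le:
  fixes b :: "nat \<Rightarrow> real" and s \<mu> a \<beta> :: real
  assumes "1 \<le> s" "N \<ge> 1" "\<And>k. 0 \<le> b k"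
    and \<beta>: "\<beta> = \<mu> - a - 1 + 1/s" "\<beta> > 0"
    and le1: "(\<Sum>k=Suc N..n. (real k powr \<mu> * b k) powr s) \<le> 1"
  shows "(\<Sum>k=Suc N..n. b k * real k powr a) \<le> (1 + 1/\<beta>) * real N powr (-\<beta>)"
proof -
  \<comment> \<open>Second argument of Young's inequality: a convergent series, normalised such that its tail
    beyond \<open>N\<close> is bounded independently of \<open>N\<close>.\<close>
  define y where "y k = real N powr \<beta> * real k powr (-1 - \<beta>)" for k :: nat
  have "b k * real k powr a \<le> real N powr (-\<beta>) * ((real k powr \<mu> * b k) powr s + y k)"
    if "k > N" for k
  proof -
    have k: "0 < real k" and N: "0 < real N" using that assms(2) by auto
    let ?w = "real k powr \<mu> * b k" and ?e = "1 - 1/s"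
    have "y k powr ?e = real N powr (\<beta> * ?e) * real k powr ((-1 - \<beta>) * ?e)"
      using k N by (simp add: y_def powr_mult powr_powr)
    moreover have "-\<beta> + \<beta> * ?e = -\<beta>/s"
      by (simp add: right_diff_distrib)
    then have "real N powr (-\<beta>) * real N powr (\<beta> * ?e) = real N powr (-\<beta>/s)"
      by (simp flip: powr_add)
    ultimately have "real N powr (-\<beta>) * y k powr ?e
        = real N powr (-\<beta>/s) * real k powr ((-1 - \<beta>) * ?e)"
      by (simp flip: mult.assoc)
    moreover have "real k powr (a - \<mu>) = real k powr (-\<beta>/s) * real k powr ((-1 - \<beta>) * ?e)"
    proof -
      have "a - \<mu> = -\<beta>/s + (-1 - \<beta>) * ?e"
        by (simp add: \<beta>(1) diff_divide_distrib add_divide_distrib algebra_simps)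
      then show ?thesis by (simp only: powr_add)
    qed
    moreover have "real k powr (-\<beta>/s) \<le> real N powr (-\<beta>/s)"
      using that N \<beta>(2) assms(1) by (intro powr_mono2') auto
    ultimately have "real k powr (a - \<mu>) \<le> real N powr (-\<beta>) * y k powr ?e"
      by (simp add: mult_right_mono)
    then have "?w * real k powr (a - \<mu>) \<le> ?w * (real N powr (-\<beta>) * y k powr ?e)"
      using assms(3) by (intro mult_left_mono) auto
    also have "\<dots> = real N powr (-\<beta>) * (?w * y k powr ?e)" by simp
    also have "\<dots> \<le> real N powr (-\<beta>) * (?w powr s + y k)"
      using assms k N by (intro mult_left_mono Young_sum_bound) (auto simp: y_def)
    also have "?w * real k powr (a - \<mu>) = b k * real k powr a"
      using k by (simp add: powr_diff)
    finally show ?thesis .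
  qed
  then have "(\<Sum>k=Suc N..n. b k * real k powr a)
      \<le> (\<Sum>k=Suc N..n. real N powr (-\<beta>) * ((real k powr \<mu> * b k) powr s + y k))"
    by (intro sum_mono) auto
  also have "\<dots> = real N powr (-\<beta>) *
      ((\<Sum>k=Suc N..n. (real k powr \<mu> * b k) powr s) + (\<Sum>k=Suc N..n. y k))"
    by (simp add: sum.distrib flip: sum_distrib_left)
  also have "\<dots> \<le> real N powr (-\<beta>) * (1 + 1/\<beta>)"
  proof (intro mult_left_mono add_mono le1)
    have "(\<Sum>k=Suc N..n. y k) = real N powr \<beta> * (\<Sum>k=Suc N..n. real k powr (-1 - \<beta>))"
      by (simp add: y_def sum_distrib_left)
    also have "\<dots> \<le> real N powr \<beta> * (real N powr (-\<beta>) / \<beta>)"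
      using \<beta>(2) assms(2) by (intro mult_left_mono sum_powr_tail_le) auto
    also have "\<dots> = 1/\<beta>"
      using assms(2) by (simp flip: powr_add)
    finally show "(\<Sum>k=Suc N..n. y k) \<le> 1/\<beta>" .
  qed simp
  finally show ?thesis by (simp add: mult.commute)
qed

text \<open>Up to the factor 2, the comparison of the \<open>\<ell>\<^sub>1\<close> and \<open>\<ell>\<^sub>p\<close> norms in dimension \<open>N\<close>; Young's inequality
  is applied with the constant sequence \<open>y = 1/N\<close>.\<close>

lemma power_mean_sum_le:
  fixes x :: "nat \<Rightarrow> real" and p :: real
  assumes "1 \<le> p" "N \<ge> 1" "\<And>k. 0 \<le> x k" "(\<Sum>k=1..N. x k powr p) \<le> 1"
  shows "(\<Sum>k=1..N. x k) \<le> 2 * real N powr (1 - 1/p)"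
proof -
  have N: "0 < real N" using assms(2) by simp
  have "(1 / real N) powr (1 - 1/p) = 1 / real N powr (1 - 1/p)"
    by (simp add: powr_divide)
  also have "\<dots> = real N powr (1/p - 1)"
    using powr_minus_divide[of "real N" "1 - 1/p"] by simp
  finally have N': "(1 / real N) powr (1 - 1/p) = real N powr (1/p - 1)" .
  have "real N powr (1/p - 1) * (\<Sum>k=1..N. x k) = (\<Sum>k=1..N. x k * (1 / real N) powr (1 - 1/p))"
    unfolding N' sum_distrib_left by (simp add: mult.commute)
  also have "\<dots> \<le> (\<Sum>k=1..N. x k powr p + 1 / real N)"
    using assms N by (intro sum_mono Young_sum_bound) auto
  also have "\<dots> \<le> 1 + 1"
    using assms(4) N by (simp add: sum.distrib)
  finally have "real N powr (1 - 1/p) * (real N powr (1/p - 1) * (\<Sum>k=1..N. x k))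
      \<le> real N powr (1 - 1/p) * 2"
    by (intro mult_left_mono) auto
  moreover have "real N powr (1 - 1/p) * real N powr (1/p - 1) = 1"
    using N by (simp flip: powr_add)
  ultimately show ?thesis by (simp flip: mult.assoc)
qed

section \<open>Truncation of the differentiated Fourier-Legendre series\<close>

lemma L2_legendre_deriv: "legendre_deriv r k \<in> L2"
  unfolding legendre_deriv_def[abs_def] by (rule L2_poly)

lemma L2_trunc_deriv: "trunc_deriv r n c \<in> L2"
  unfolding trunc_deriv_def[abs_def] by (intro L2_sum L2_cmult L2_legendre_deriv)

lemma L2_norm_legendre_deriv_sum_le:
  assumes "r \<ge> 1" "0 \<notin> A"
  shows "L2_norm (\<lambda>t. \<Sum>k\<in>A. c k * legendre_deriv r k t)
    \<le> 2 ^ Suc r * (\<Sum>k\<in>A. \<bar>c k\<bar> * real k powr (2 * real r - 1/2))"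
proof -
  have "L2_norm (\<lambda>t. \<Sum>k\<in>A. c k * legendre_deriv r k t)
      \<le> (\<Sum>k\<in>A. L2_norm (\<lambda>t. c k * legendre_deriv r k t))"
    by (intro L2_norm_sum_le L2_cmult L2_legendre_deriv)
  also have "\<dots> \<le> (\<Sum>k\<in>A. \<bar>c k\<bar> * (2 ^ Suc r * real k powr (2 * real r - 1/2)))"
  proof (rule sum_mono)
    fix k assume "k \<in> A"
    then have "k \<ge> 1" using assms(2) by (cases k) auto
    then show "L2_norm (\<lambda>t. c k * legendre_deriv r k t)
        \<le> \<bar>c k\<bar> * (2 ^ Suc r * real k powr (2 * real r - 1/2))"
      unfolding L2_norm_cmult
      by (intro mult_left_mono L2_norm_legendre_deriv assms(1)) simp_all
  qed
  also have "\<dots> = 2 ^ Suc r * (\<Sum>k\<in>A. \<bar>c k\<bar> * real k powr (2 * real r - 1/2))"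
    by (simp only: sum_distrib_left mult.left_commute)
  finally show ?thesis .
qed

text \<open>The index 0 is left out so that \<open>max 1 k\<close> in the weight is just \<open>k\<close>.\<close>

lemma wiener_unit_ball_sum_le:
  assumes s: "1 \<le> s" and f: "f \<in> wiener_class s \<mu>" "wiener_norm s \<mu> f \<le> 1"
    and A: "finite A" "0 \<notin> A"
  shows "(\<Sum>k\<in>A. (real k powr \<mu> * \<bar>fl_coeff f k\<bar>) powr s) \<le> 1"
proof -
  have summ: "summable (wiener_term s \<mu> f)"
    using f(1) by (simp add: wiener_class_def)
  have "(real k powr \<mu> * \<bar>fl_coeff f k\<bar>) powr s = wiener_term s \<mu> f k" if "k \<in> A" for k
  proof -
    have "max 1 (real k) = real k" using that A(2) by (cases k) auto
    then show ?thesis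
      by (simp add: wiener_term_def powr_mult powr_powr mult.commute)
  qed
  then have "(\<Sum>k\<in>A. (real k powr \<mu> * \<bar>fl_coeff f k\<bar>) powr s) = (\<Sum>k\<in>A. wiener_term s \<mu> f k)"
    by (intro sum.cong) auto
  also have "\<dots> \<le> (\<Sum>k. wiener_term s \<mu> f k)"
    by (intro sum_le_suminf summ A(1)) (simp add: wiener_term_def)
  also have "\<dots> \<le> 1"
  proof (rule ccontr)
    assume "\<not> (\<Sum>k. wiener_term s \<mu> f k) \<le> 1"
    then have "1 < (\<Sum>k. wiener_term s \<mu> f k) powr (1/s)"
      using s by (intro gr_one_powr) auto
    then show False using f(2) by (simp add: wiener_norm_def)
  qed
  finally show ?thesis .
qed

text \<open>The truncation part of the error, and also the source of the absolute convergence of the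
  differentiated series in \<open>L\<^sub>2\<close>.\<close>

lemma wiener_unit_ball_tail_le:
  assumes "1 \<le> s" "f \<in> wiener_class s \<mu>" "wiener_norm s \<mu> f \<le> 1" "N \<ge> 1"
    and "\<beta> = \<mu> - 2 * real r + 1/s - 1/2" "\<beta> > 0"
  shows "(\<Sum>k=Suc N..n. \<bar>fl_coeff f k\<bar> * real k powr (2 * real r - 1/2))
    \<le> (1 + 1/\<beta>) * real N powr (-\<beta>)"
  using assms wiener_unit_ball_sum_le[OF assms(1-3), of "{Suc N..n}"]
  by (intro weighted_tail_le[where s = s and \<mu> = \<mu>]) auto

text \<open>The noise enters only through its first \<open>N\<close> entries, where the \<open>\<ell>\<^sub>p\<close> bound is converted to an
  \<open>\<ell>\<^sub>1\<close> bound.\<close>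

lemma lp_norm_le_imp_sum_le:
  assumes p: "1 \<le> p" and \<xi>: "\<xi> \<in> lp_space p" "lp_norm p \<xi> \<le> \<delta>" and "0 < \<delta>" "N \<ge> 1"
  shows "(\<Sum>k=1..N. \<bar>\<xi> k\<bar>) \<le> 2 * \<delta> * real N powr (1 - real_of_ereal (1/p))"
proof (cases p)
  case (real p')
  then have p': "1 \<le> p'" "p \<noteq> \<infinity>" "real_of_ereal p = p'" using p by auto
  have summ: "summable (\<lambda>k. \<bar>\<xi> k\<bar> powr p')"
    using \<xi>(1) p' by (simp add: lp_space_def)
  have "(\<Sum>k. \<bar>\<xi> k\<bar> powr p') \<le> \<delta> powr p'"
  proof -
    have "((\<Sum>k. \<bar>\<xi> k\<bar> powr p') powr (1/p')) powr p' \<le> \<delta> powr p'"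
      using \<xi>(2) p' by (intro powr_mono2) (auto simp: lp_norm_def)
    moreover have "0 \<le> (\<Sum>k. \<bar>\<xi> k\<bar> powr p')"
      by (intro suminf_nonneg summ) auto
    ultimately show ?thesis using p'(1) by (simp add: powr_powr)
  qed
  moreover have "(\<Sum>k=1..N. \<bar>\<xi> k\<bar> powr p') \<le> (\<Sum>k. \<bar>\<xi> k\<bar> powr p')"
    by (intro sum_le_suminf summ) auto
  ultimately have "(\<Sum>k=1..N. \<bar>\<xi> k\<bar> powr p') / \<delta> powr p' \<le> 1"
    using \<open>0 < \<delta>\<close> by simp
  then have "(\<Sum>k=1..N. (\<bar>\<xi> k\<bar> / \<delta>) powr p') \<le> 1"
    using \<open>0 < \<delta>\<close> by (simp add: powr_divide sum_divide_distrib)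
  then have "(\<Sum>k=1..N. \<bar>\<xi> k\<bar> / \<delta>) \<le> 2 * real N powr (1 - 1/p')"
    using p' assms by (intro power_mean_sum_le) auto
  then have "(\<Sum>k=1..N. \<bar>\<xi> k\<bar>) \<le> 2 * real N powr (1 - 1/p') * \<delta>"
    using \<open>0 < \<delta>\<close> by (simp add: pos_divide_le_eq flip: sum_divide_distrib)
  moreover have "real_of_ereal (1/p) = 1/p'"
    using real p'(1) by (simp add: one_ereal_def)
  ultimately show ?thesis by (simp add: mult_ac)
next
  case PInf
  have "\<bar>\<xi> k\<bar> \<le> \<delta>" for k
  proof -
    have "\<bar>\<xi> k\<bar> \<le> (SUP k. \<bar>\<xi> k\<bar>)"
      using \<xi>(1) PInf by (intro cSUP_upper) (auto simp: lp_space_def)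
    then show ?thesis using \<xi>(2) PInf by (simp add: lp_norm_def)
  qed
  then have "(\<Sum>k=1..N. \<bar>\<xi> k\<bar>) \<le> (\<Sum>k=1..N. \<delta>)"
    by (intro sum_mono)
  also have "\<dots> \<le> 2 * \<delta> * real N"
    using \<open>0 < \<delta>\<close> by simp
  finally show ?thesis using PInf by simp
qed (use p in simp)

lemma has_series_deriv_exists:
  assumes r: "r \<ge> 1" and f: "1 \<le> s" "f \<in> wiener_class s \<mu>" "wiener_norm s \<mu> f \<le> 1"
    and \<beta>: "\<beta> = \<mu> - 2 * real r + 1/s - 1/2" "\<beta> > 0"
  shows "\<exists>g. has_series_deriv r f g"
proof -
  define u where "u k = (if k < r then (\<lambda>t. 0) else (\<lambda>t. fl_coeff f k * legendre_deriv r k t))" for k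
  have u: "u k \<in> L2" for k
    by (simp add: u_def L2_zero L2_cmult L2_legendre_deriv)
  have "summable (\<lambda>k. L2_norm (u (k + Suc r)))"
  proof (rule bounded_imp_summable)
    fix n
    have "(\<Sum>k\<le>n. L2_norm (u (k + Suc r))) = (\<Sum>k=Suc r..n + Suc r. L2_norm (u k))"
      using sum.shift_bounds_cl_nat_ivl[of "\<lambda>k. L2_norm (u k)" 0 "Suc r" n]
      by (simp only: atMost_atLeast0 add_0)
    also have "\<dots> \<le> (\<Sum>k=Suc r..n + Suc r. 2 ^ Suc r * (\<bar>fl_coeff f k\<bar> * real k powr (2 * real r - 1/2)))"
    proof (rule sum_mono)
      fix k assume k: "k \<in> {Suc r..n + Suc r}"
      then have "u k = (\<lambda>t. fl_coeff f k * legendre_deriv r k t)"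
        by (auto simp: u_def)
      then have "L2_norm (u k) = \<bar>fl_coeff f k\<bar> * L2_norm (legendre_deriv r k)"
        by (simp add: L2_norm_cmult)
      also have "\<dots> \<le> \<bar>fl_coeff f k\<bar> * (2 ^ Suc r * real k powr (2 * real r - 1/2))"
        using k by (intro mult_left_mono L2_norm_legendre_deriv r) auto
      finally show "L2_norm (u k) \<le> 2 ^ Suc r * (\<bar>fl_coeff f k\<bar> * real k powr (2 * real r - 1/2))"
        by (simp only: mult.left_commute)
    qed
    also have "\<dots> \<le> 2 ^ Suc r * ((1 + 1/\<beta>) * real r powr (-\<beta>))"
      unfolding sum_distrib_left[symmetric]
      by (intro mult_left_mono wiener_unit_ball_tail_le[OF f r \<beta>]) simp
    finally show "(\<Sum>k\<le>n. L2_norm (u (k + Suc r))) \<le> 2 ^ Suc r * ((1 + 1/\<beta>) * real r powr (-\<beta>))" .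
  qed (simp add: L2_norm_nonneg)
  then have "summable (\<lambda>k. L2_norm (u k))"
    by (subst (asm) summable_iff_shift)
  then obtain g where g: "g \<in> L2" "(\<lambda>n. L2_norm (\<lambda>t. g t - (\<Sum>k<n. u k t))) \<longlonglongrightarrow> 0"
    using L2_series_converges[of u] u by blast
  have "(\<Sum>k<Suc n. u k t) = trunc_deriv r n (fl_coeff f) t" for n t
    unfolding trunc_deriv_def
    by (rule sum.mono_neutral_cong_right) (auto simp: u_def)
  then have "(\<lambda>n. L2_norm (\<lambda>t. g t - trunc_deriv r n (fl_coeff f) t)) \<longlonglongrightarrow> 0"
    using LIMSEQ_Suc[OF g(2)] by simp
  then show ?thesis
    using g(1) by (auto simp: has_series_deriv_def)
qed

text \<open>For \<open>n \<ge> N\<close> the error splits into the remainder of the series after \<open>n\<close>, the exact terms between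
  \<open>N\<close> and \<open>n\<close>, and the noise up to \<open>N\<close>. Letting \<open>n\<close> tend to infinity removes the first part, so
  the bound holds for whichever representative \<open>g\<close> of the derivative is chosen.\<close>

lemma L2_norm_truncation_error_le:
  assumes r: "1 \<le> r" "r \<le> N" and g: "has_series_deriv r f g"
    and tail: "\<And>n. (\<Sum>k=Suc N..n. \<bar>fl_coeff f k\<bar> * real k powr (2 * real r - 1/2)) \<le> T"
    and noise: "(\<Sum>k=r..N. \<bar>fl_coeff f k - y k\<bar> * real k powr (2 * real r - 1/2)) \<le> E"
  shows "L2_norm (\<lambda>t. g t - trunc_deriv r N y t) \<le> 2 ^ Suc r * (T + E)"
proof -
  let ?c = "fl_coeff f" and ?h = "legendre_deriv r"
  have gL2: "g \<in> L2" and lim: "(\<lambda>n. L2_norm (\<lambda>t. g t - trunc_deriv r n ?c t)) \<longlonglongrightarrow> 0"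
    using g by (auto simp: has_series_deriv_def)
  have "L2_norm (\<lambda>t. g t - trunc_deriv r N y t)
      \<le> L2_norm (\<lambda>t. g t - trunc_deriv r n ?c t) + 2 ^ Suc r * (T + E)" if "n \<ge> N" for n
  proof -
    let ?S = "\<lambda>t. \<Sum>k=Suc N..n. ?c k * ?h k t" and ?R = "\<lambda>t. \<Sum>k=r..N. (?c k - y k) * ?h k t"
    have split: "{r..n} = {r..N} \<union> {Suc N..n}" using that r by auto
    have diff: "trunc_deriv r n ?c t - trunc_deriv r N y t = ?S t + ?R t" for t
      unfolding trunc_deriv_def split
      by (subst sum.union_disjoint) (auto simp: left_diff_distrib sum_subtractf)
    have eq: "(\<lambda>t. g t - trunc_deriv r N y t)
        = (\<lambda>t. (g t - trunc_deriv r n ?c t) + (?S t + ?R t))"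
      unfolding diff[symmetric] by simp
    have L2: "?S \<in> L2" "?R \<in> L2"
      by (intro L2_sum L2_cmult L2_legendre_deriv)+
    have "L2_norm (\<lambda>t. g t - trunc_deriv r N y t)
        \<le> L2_norm (\<lambda>t. g t - trunc_deriv r n ?c t) + L2_norm (\<lambda>t. ?S t + ?R t)"
      unfolding eq by (intro L2_norm_triangle L2_diff L2_add gL2 L2_trunc_deriv L2)
    also have "L2_norm (\<lambda>t. ?S t + ?R t) \<le> L2_norm ?S + L2_norm ?R"
      by (intro L2_norm_triangle L2)
    also have "L2_norm ?S \<le> 2 ^ Suc r * T"
      by (rule order_trans[OF L2_norm_legendre_deriv_sum_le])
         (use r tail in \<open>auto intro: mult_left_mono\<close>)
    also have "L2_norm ?R \<le> 2 ^ Suc r * E"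
      by (rule order_trans[OF L2_norm_legendre_deriv_sum_le])
         (use r noise in \<open>auto intro: mult_left_mono\<close>)
    finally show ?thesis by (simp add: distrib_left)
  qed
  then have "\<forall>\<^sub>F n in sequentially. L2_norm (\<lambda>t. g t - trunc_deriv r N y t)
      \<le> L2_norm (\<lambda>t. g t - trunc_deriv r n ?c t) + 2 ^ Suc r * (T + E)"
    by (auto simp: eventually_sequentially)
  moreover have "(\<lambda>n. L2_norm (\<lambda>t. g t - trunc_deriv r n ?c t) + 2 ^ Suc r * (T + E))
      \<longlonglongrightarrow> 0 + 2 ^ Suc r * (T + E)"
    by (intro tendsto_add lim tendsto_const)
  ultimately show ?thesis
    using tendsto_lowerbound[OF _ _ trivial_limit_sequentially] by fastforce
qed

theorem theorem3p3:
  fixes r :: nat and s \<mu> C1 C2 :: real and p :: ereal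
  defines "q \<equiv> real_of_ereal (1 / p)"
  assumes "r \<ge> 1" and "1 \<le> s" and "1 \<le> p"
    and "\<mu> > 2 * real r - 1 / s + 1 / 2"
    and "C1 > 0" and "C2 > 0"
  shows "\<exists>c>0. \<forall>(\<delta>::real) (f::real \<Rightarrow> real) (y::nat \<Rightarrow> real) (N::nat).
    0 < \<delta> \<and> \<delta> < 1 \<and>
    f \<in> wiener_class s \<mu> \<and> wiener_norm s \<mu> f \<le> 1 \<and>
    (\<lambda>k. fl_coeff f k - y k) \<in> lp_space p \<and>
    lp_norm p (\<lambda>k. fl_coeff f k - y k) \<le> \<delta> \<and>
    r \<le> N \<and>
    C1 * \<delta> powr (- (1 / (\<mu> - q + 1 / s))) \<le> real N \<and>
    real N \<le> C2 * \<delta> powr (- (1 / (\<mu> - q + 1 / s)))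
    \<longrightarrow> (\<exists>g. has_series_deriv r f g) \<and>
        (\<forall>g. has_series_deriv r f g \<longrightarrow>
          L2_norm (\<lambda>t. g t - trunc_deriv r N y t)
            \<le> c * \<delta> powr ((\<mu> - 2 * real r + 1 / s - 1 / 2) / (\<mu> - q + 1 / s)))"
proof -
  \<comment> \<open>The truncation error is of order \<open>N powr (-\<beta>)\<close>, the noise of order \<open>\<delta> * N powr e\<close>. The given
    choice of \<open>N\<close> balances the two, which works out because \<open>\<nu> = \<beta> + e\<close>.\<close>
  define \<beta> \<nu> e where "\<beta> = \<mu> - 2 * real r + 1/s - 1/2" and "\<nu> = \<mu> - q + 1/s"
    and "e = 2 * real r + 1/2 - q"
  have \<beta>: "\<beta> > 0" using assms by (simp add: \<beta>_def)
  have q: "q \<le> 1"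
  proof (cases p)
    case (real p')
    then show ?thesis using \<open>1 \<le> p\<close> by (simp add: q_def one_ereal_def)
  qed (use \<open>1 \<le> p\<close> in \<open>simp_all add: q_def\<close>)
  have e: "e > 0" using q \<open>r \<ge> 1\<close> by (simp add: e_def)
  have \<nu>: "\<nu> = \<beta> + e" by (simp add: \<nu>_def \<beta>_def e_def)
  then have "\<nu> > 0" using \<beta> e by simp
  define c where "c = 2 ^ Suc r * ((1 + 1/\<beta>) * C1 powr (-\<beta>) + 2 * C2 powr e)"
  have "c > 0"
    using \<beta> \<open>C1 > 0\<close> by (auto simp: c_def intro!: mult_pos_pos add_pos_nonneg)
  moreover have "(\<exists>g. has_series_deriv r f g) \<and>
      (\<forall>g. has_series_deriv r f g \<longrightarrow>
         L2_norm (\<lambda>t. g t - trunc_deriv r N y t) \<le> c * \<delta> powr (\<beta> / \<nu>))"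
    if \<delta>: "0 < \<delta>" and f: "f \<in> wiener_class s \<mu>" "wiener_norm s \<mu> f \<le> 1"
      and \<xi>: "(\<lambda>k. fl_coeff f k - y k) \<in> lp_space p"
        "lp_norm p (\<lambda>k. fl_coeff f k - y k) \<le> \<delta>"
      and N: "r \<le> N" "C1 * \<delta> powr (- (1/\<nu>)) \<le> real N" "real N \<le> C2 * \<delta> powr (- (1/\<nu>))"
    for \<delta> f y N
  proof (intro conjI allI impI)
    show "\<exists>g. has_series_deriv r f g"
      using has_series_deriv_exists[OF \<open>r \<ge> 1\<close> \<open>1 \<le> s\<close> f \<beta>_def \<beta>] .
    fix g assume g: "has_series_deriv r f g"
    have N1: "N \<ge> 1" using N \<open>r \<ge> 1\<close> by simp
    have "(\<Sum>k=Suc N..n. \<bar>fl_coeff f k\<bar> * real k powr (2 * real r - 1/2))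
        \<le> (1 + 1/\<beta>) * (C1 powr (-\<beta>) * \<delta> powr (\<beta>/\<nu>))" for n
    proof -
      have "real N powr (-\<beta>) \<le> (C1 * \<delta> powr (- (1/\<nu>))) powr (-\<beta>)"
        using N \<beta> \<delta> \<open>C1 > 0\<close> by (intro powr_mono2') auto
      also have "\<dots> = C1 powr (-\<beta>) * \<delta> powr (\<beta>/\<nu>)"
        using \<delta> \<open>C1 > 0\<close> by (simp add: powr_mult powr_powr)
      finally have "(1 + 1/\<beta>) * real N powr (-\<beta>) \<le> (1 + 1/\<beta>) * (C1 powr (-\<beta>) * \<delta> powr (\<beta>/\<nu>))"
        using \<beta> by (intro mult_left_mono) auto
      then show ?thesis
        using wiener_unit_ball_tail_le[OF \<open>1 \<le> s\<close> f N1 \<beta>_def \<beta>, of n] by linarith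
    qed
    moreover have "(\<Sum>k=r..N. \<bar>fl_coeff f k - y k\<bar> * real k powr (2 * real r - 1/2))
        \<le> 2 * (C2 powr e * \<delta> powr (\<beta>/\<nu>))"
    proof -
      have "(\<Sum>k=r..N. \<bar>fl_coeff f k - y k\<bar> * real k powr (2 * real r - 1/2))
          \<le> (\<Sum>k=r..N. \<bar>fl_coeff f k - y k\<bar> * real N powr (2 * real r - 1/2))"
        using \<open>r \<ge> 1\<close> by (intro sum_mono mult_left_mono powr_mono2) auto
      also have "\<dots> \<le> (\<Sum>k=1..N. \<bar>fl_coeff f k - y k\<bar> * real N powr (2 * real r - 1/2))"
        using \<open>r \<ge> 1\<close> by (intro sum_mono2) auto
      also have "\<dots> = (\<Sum>k=1..N. \<bar>fl_coeff f k - y k\<bar>) * real N powr (2 * real r - 1/2)"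
        by (simp only: sum_distrib_right)
      also have "\<dots> \<le> (2 * \<delta> * real N powr (1 - q)) * real N powr (2 * real r - 1/2)"
        unfolding q_def
        by (intro mult_right_mono lp_norm_le_imp_sum_le[OF \<open>1 \<le> p\<close> \<xi> \<delta> N1]) simp
      also have "\<dots> = 2 * \<delta> * real N powr e"
      proof -
        have "(1 - q) + (2 * real r - 1/2) = e" by (simp add: e_def)
        then show ?thesis by (simp only: mult.assoc powr_add[symmetric])
      qed
      also have "\<dots> \<le> 2 * \<delta> * (C2 * \<delta> powr (- (1/\<nu>))) powr e"
        using N e \<delta> by (intro mult_left_mono powr_mono2) auto
      also have "\<dots> = 2 * (C2 powr e * (\<delta> powr 1 * \<delta> powr (- (e/\<nu>))))"
        using \<delta> \<open>C2 > 0\<close> by (simp add: powr_mult powr_powr)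
      also have "\<delta> powr 1 * \<delta> powr (- (e/\<nu>)) = \<delta> powr (1 - e/\<nu>)"
        by (simp only: powr_add[symmetric]) simp
      also have "1 - e/\<nu> = \<beta>/\<nu>"
        using \<open>\<nu> > 0\<close> \<nu> by (simp add: field_simps)
      finally show ?thesis .
    qed
    ultimately have "L2_norm (\<lambda>t. g t - trunc_deriv r N y t)
      \<le> 2 ^ Suc r * ((1 + 1/\<beta>) * (C1 powr (-\<beta>) * \<delta> powr (\<beta>/\<nu>)) + 2 * (C2 powr e * \<delta> powr (\<beta>/\<nu>)))"
      by (rule L2_norm_truncation_error_le[OF \<open>r \<ge> 1\<close> N(1) g])
    also have "\<dots> = c * \<delta> powr (\<beta>/\<nu>)"
      unfolding c_def by (simp only: distrib_right mult.assoc)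
    finally show "L2_norm (\<lambda>t. g t - trunc_deriv r N y t) \<le> c * \<delta> powr (\<beta>/\<nu>)" .
  qed
  ultimately show ?thesis
    unfolding \<beta>_def \<nu>_def by blast
qed

end
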